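(* Let $n\ge 1$ and let $A\in M_n(\mathbb{H})$. Then every section of the quaternionic numerical range of $A$ is convex; that is, for every $m\in\mathbb{S}$ the set $W_{\mathbb{H}}(A)\cap\mathbb{C}_m^{+}$ is convex.
   Context: $\mathbb{H}$ denotes the real quaternions, with units $i,j,k$, and $M_n(\mathbb{H})$ the $n\times n$ quaternionic matrices. $\mathbb{H}^n$ is a right quaternionic Hilbert space with inner product $\langle (p_l),(q_l)\rangle_{\mathbb{H}}=\sum_{l=1}^n\overline{p_l}\,q_l$ and norm $\|X\|=\langle X,X\rangle_{\mathbb{H}}^{1/2}$; matrices act on column vectors from the left. $S_{\mathbb{H}^n}=\{X\in\mathbb{H}^n:\|X\|=1\}$. The quaternionic numerical range of $A$ is $W_{\mathbb{H}}(A)=\{\langle X,AX\rangle_{\mathbb{H}}: X\in S_{\mathbb{H}^n}\}\subseteq\mathbb{H}$. $\mathbb{S}=\{q\in\mathbb{H}: q^2=-1\}$ is the set of imaginary unit quaternions. For $m\in\mathbb{S}$, $\mathbb{C}_m^{+}=\{\alpha+m\beta:\alpha,\beta\in\mathbb{R},\ \beta\ge 0\}$ is the closed upper half plane of the slice $\mathbb{C}_m=\{\alpha+m\beta:\alpha,\beta\in\mathbb{R}\}$, and the $\mathbb{C}_m$-section of $W_{\mathbb{H}}(A)$ is $W_{\mathbb{H}}(A)\cap\mathbb{C}_m^{+}$. Convexity is in the real vector space $\mathbb{H}\cong\mathbb{R}^4$. *)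

theory Defs
  imports "HOL-Analysis.Analysis"
begin

text \<open>The real quaternions: \<open>Quat a b c d\<close> stands for $a + b i + c j + d k$.\<close>

datatype quat = Quat (qRe: real) (qIm1: real) (qIm2: real) (qIm3: real)

lemma quat_eq_iff:
  "x = y \<longleftrightarrow> qRe x = qRe y \<and> qIm1 x = qIm1 y \<and> qIm2 x = qIm2 y \<and> qIm3 x = qIm3 y"
  by (cases x; cases y) simp

instantiation quat :: ring_1
begin

definition "0 = Quat 0 0 0 0"

definition "1 = Quat 1 0 0 0"

definition "x + y = Quat (qRe x + qRe y) (qIm1 x + qIm1 y) (qIm2 x + qIm2 y) (qIm3 x + qIm3 y)"

definition "- x = Quat (- qRe x) (- qIm1 x) (- qIm2 x) (- qIm3 x)"

definition "x - y = Quat (qRe x - qRe y) (qIm1 x - qIm1 y) (qIm2 x - qIm2 y) (qIm3 x - qIm3 y)"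

definition "x * y = Quat
  (qRe x * qRe y - qIm1 x * qIm1 y - qIm2 x * qIm2 y - qIm3 x * qIm3 y)
  (qRe x * qIm1 y + qIm1 x * qRe y + qIm2 x * qIm3 y - qIm3 x * qIm2 y)
  (qRe x * qIm2 y - qIm1 x * qIm3 y + qIm2 x * qRe y + qIm3 x * qIm1 y)
  (qRe x * qIm3 y + qIm1 x * qIm2 y - qIm2 x * qIm1 y + qIm3 x * qRe y)"

instance
  by standard
    (simp_all add: zero_quat_def one_quat_def plus_quat_def uminus_quat_def minus_quat_def
      times_quat_def algebra_simps)

end

instantiation quat :: real_algebra_1
begin

definition "r *\<^sub>R x = Quat (r * qRe x) (r * qIm1 x) (r * qIm2 x) (r * qIm3 x)"

instance
  by standard
    (simp_all add: scaleR_quat_def plus_quat_def times_quat_def algebra_simps)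

end

lemma quat_sel_simps [simp]:
  "qRe 0 = 0" "qIm1 0 = 0" "qIm2 0 = 0" "qIm3 0 = 0"
  "qRe 1 = 1" "qIm1 1 = 0" "qIm2 1 = 0" "qIm3 1 = 0"
  "qRe (x + y) = qRe x + qRe y" "qIm1 (x + y) = qIm1 x + qIm1 y"
  "qIm2 (x + y) = qIm2 x + qIm2 y" "qIm3 (x + y) = qIm3 x + qIm3 y"
  "qRe (- x) = - qRe x" "qIm1 (- x) = - qIm1 x" "qIm2 (- x) = - qIm2 x" "qIm3 (- x) = - qIm3 x"
  "qRe (x - y) = qRe x - qRe y" "qIm1 (x - y) = qIm1 x - qIm1 y"
  "qIm2 (x - y) = qIm2 x - qIm2 y" "qIm3 (x - y) = qIm3 x - qIm3 y"
  "qRe (r *\<^sub>R x) = r * qRe x" "qIm1 (r *\<^sub>R x) = r * qIm1 x"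
  "qIm2 (r *\<^sub>R x) = r * qIm2 x" "qIm3 (r *\<^sub>R x) = r * qIm3 x"
  "qRe (of_real r) = r" "qIm1 (of_real r) = 0" "qIm2 (of_real r) = 0" "qIm3 (of_real r) = 0"
  by (simp_all add: zero_quat_def one_quat_def plus_quat_def uminus_quat_def minus_quat_def
      scaleR_quat_def of_real_def)

definition quat_i :: quat where "quat_i = Quat 0 1 0 0"
definition quat_j :: quat where "quat_j = Quat 0 0 1 0"
definition quat_k :: quat where "quat_k = Quat 0 0 0 1"

lemma quat_units:
  "quat_i * quat_i = - 1" "quat_j * quat_j = - 1" "quat_k * quat_k = - 1"
  "quat_i * quat_j = quat_k" "quat_j * quat_k = quat_i" "quat_k * quat_i = quat_j"
  "quat_j * quat_i = - quat_k" "quat_k * quat_j = - quat_i" "quat_i * quat_k = - quat_j"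
  by (simp_all add: quat_i_def quat_j_def quat_k_def times_quat_def one_quat_def uminus_quat_def)

lemma quat_expand:
  "x = of_real (qRe x) + of_real (qIm1 x) * quat_i + of_real (qIm2 x) * quat_j
     + of_real (qIm3 x) * quat_k"
  by (simp add: quat_eq_iff times_quat_def quat_i_def quat_j_def quat_k_def)

definition quat_cnj :: "quat \<Rightarrow> quat" where
  "quat_cnj q = Quat (qRe q) (- qIm1 q) (- qIm2 q) (- qIm3 q)"

definition quat_inner :: "quat ^ 'n \<Rightarrow> quat ^ 'n \<Rightarrow> quat" where
  "quat_inner p q = (\<Sum>l\<in>UNIV. quat_cnj (p $ l) * q $ l)"

text \<open>\<open>quat_inner X X\<close> is a nonnegative real (\<open>quat_inner_self\<close>), so its square root may be
  taken of the real part.\<close>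

definition quat_vec_norm :: "quat ^ 'n \<Rightarrow> real" where
  "quat_vec_norm X = sqrt (qRe (quat_inner X X))"

lemma quat_inner_self:
  "quat_inner X X = of_real (qRe (quat_inner X X))" "0 \<le> qRe (quat_inner X X)"
proof -
  have *: "quat_cnj q * q = of_real ((qRe q)\<^sup>2 + (qIm1 q)\<^sup>2 + (qIm2 q)\<^sup>2 + (qIm3 q)\<^sup>2)" for q
    by (simp add: quat_eq_iff quat_cnj_def times_quat_def power2_eq_square)
  have "quat_inner X X = of_real (\<Sum>l\<in>UNIV. (qRe (X $ l))\<^sup>2 + (qIm1 (X $ l))\<^sup>2
      + (qIm2 (X $ l))\<^sup>2 + (qIm3 (X $ l))\<^sup>2)" (is "_ = of_real ?s")
    unfolding quat_inner_def * of_real_sum ..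
  moreover have "0 \<le> ?s"
    by (intro sum_nonneg) simp
  ultimately show "quat_inner X X = of_real (qRe (quat_inner X X))" "0 \<le> qRe (quat_inner X X)"
    by (simp_all del: of_real_sum of_real_add of_real_power)
qed

definition quat_unit_sphere :: "(quat ^ 'n) set" where
  "quat_unit_sphere = {X. quat_vec_norm X = 1}"

definition quat_num_range :: "quat ^ 'n ^ 'n \<Rightarrow> quat set" where
  "quat_num_range A = {quat_inner X (A *v X) | X. X \<in> quat_unit_sphere}"

definition imag_units :: "quat set" where
  "imag_units = {q. q\<^sup>2 = - 1}"

definition upper_half_slice :: "quat \<Rightarrow> quat set" where
  "upper_half_slice m = {of_real \<alpha> + m * of_real \<beta> | \<alpha> \<beta>. 0 \<le> \<beta>}"

end

theory Submission imports Defs begin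

text \<open>Conjugation by unit quaternions reduces the claim to convexity of the planar set of pairs
  $(\mathrm{Re}\, q, |\mathrm{Im}\, q|)$ with $q = \langle X, AX\rangle$, $X$ a unit vector. Given unit
  vectors $X$ and $Y$, consider $q$ along the real segment from $X$ to $Yu$; the unit quaternion $u$
  leaves the two end points of the planar curve unchanged, and different choices of $u$ control the
  cross term. One choice gives a curve below the chord, another one a curve above it, and if both ends
  have the same real part a third one keeps the real part constant. The intermediate value theorem,
  first for $\mathrm{Re}\, q$ on the first two curves and then for $|\mathrm{Im}\, q|$ on a curve
  of the third kind, hits every point of the chord.\<close>

subsection \<open>Quaternions\<close>

text \<open>The target is a product of reals so that its \<open>norm\<close> and inner product are
  the Euclidean ones of the imaginary part.\<close>

definition quat_Im :: "quat \<Rightarrow> real \<times> real \<times> real" where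
  "quat_Im q = (qIm1 q, qIm2 q, qIm3 q)"

definition quat_nsq :: "quat \<Rightarrow> real" where
  "quat_nsq q = (qRe q)\<^sup>2 + (qIm1 q)\<^sup>2 + (qIm2 q)\<^sup>2 + (qIm3 q)\<^sup>2"

lemma quat_mult_sel [simp]:
  "qRe (x * y) = qRe x * qRe y - qIm1 x * qIm1 y - qIm2 x * qIm2 y - qIm3 x * qIm3 y"
  "qIm1 (x * y) = qRe x * qIm1 y + qIm1 x * qRe y + qIm2 x * qIm3 y - qIm3 x * qIm2 y"
  "qIm2 (x * y) = qRe x * qIm2 y - qIm1 x * qIm3 y + qIm2 x * qRe y + qIm3 x * qIm1 y"
  "qIm3 (x * y) = qRe x * qIm3 y + qIm1 x * qIm2 y - qIm2 x * qIm1 y + qIm3 x * qRe y"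
  by (simp_all add: times_quat_def)

lemma quat_cnj_sel [simp]:
  "qRe (quat_cnj x) = qRe x" "qIm1 (quat_cnj x) = - qIm1 x"
  "qIm2 (quat_cnj x) = - qIm2 x" "qIm3 (quat_cnj x) = - qIm3 x"
  by (simp_all add: quat_cnj_def)

lemma quat_cnj_add: "quat_cnj (x + y) = quat_cnj x + quat_cnj y"
  and quat_cnj_mult: "quat_cnj (x * y) = quat_cnj y * quat_cnj x"
  and quat_cnj_scaleR: "quat_cnj (r *\<^sub>R x) = r *\<^sub>R quat_cnj x"
  and quat_cnj_mult_self: "quat_cnj x * x = of_real (quat_nsq x)"
  by (simp_all add: quat_eq_iff quat_nsq_def power2_eq_square algebra_simps)

lemma quat_Im_add: "quat_Im (x + y) = quat_Im x + quat_Im y"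
  and quat_Im_scaleR: "quat_Im (r *\<^sub>R x) = r *\<^sub>R quat_Im x"
  by (simp_all add: quat_Im_def)

lemma quat_nsq_nonneg: "0 \<le> quat_nsq x"
  by (simp add: quat_nsq_def)

lemma quat_nsq_eq_0_iff: "quat_nsq x = 0 \<longleftrightarrow> x = 0"
proof
  assume "quat_nsq x = 0"
  then have "(qRe x)\<^sup>2 = 0 \<and> (qIm1 x)\<^sup>2 = 0 \<and> (qIm2 x)\<^sup>2 = 0 \<and> (qIm3 x)\<^sup>2 = 0"
    unfolding quat_nsq_def
    using zero_le_power2[of "qRe x"] zero_le_power2[of "qIm1 x"] zero_le_power2[of "qIm2 x"]
      zero_le_power2[of "qIm3 x"] by linarith
  then show "x = 0"
    by (simp add: quat_eq_iff)
qed (simp add: quat_nsq_def)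

lemma quat_nsq_eq: "quat_nsq x = (qRe x)\<^sup>2 + (norm (quat_Im x))\<^sup>2"
  by (simp add: quat_nsq_def quat_Im_def norm_Pair)

text \<open>Euler's four-square identity.\<close>

lemma quat_nsq_mult: "quat_nsq (x * y) = quat_nsq x * quat_nsq y"
  by (simp add: quat_nsq_def power2_eq_square algebra_simps)

lemma quat_nsq_cnj: "quat_nsq (quat_cnj x) = quat_nsq x"
  by (simp add: quat_nsq_def)

lemma quat_nsq_scaleR: "quat_nsq (r *\<^sub>R x) = r\<^sup>2 * quat_nsq x"
  by (simp add: quat_nsq_def power_mult_distrib algebra_simps)

section \<open>Unit quaternions and conjugation by them\<close>

lemma quat_normalize:
  assumes "x \<noteq> 0"
  obtains r where "r > 0" "quat_nsq (r *\<^sub>R x) = 1"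
proof
  have pos: "quat_nsq x > 0"
    using assms quat_nsq_nonneg[of x] quat_nsq_eq_0_iff[of x] by linarith
  then show "inverse (sqrt (quat_nsq x)) > 0"
    by simp
  show "quat_nsq (inverse (sqrt (quat_nsq x)) *\<^sub>R x) = 1"
    using pos by (simp add: quat_nsq_scaleR power_inverse)
qed

lemma qRe_conjugate:
  assumes "quat_nsq u = 1"
  shows "qRe (quat_cnj u * q * u) = qRe q"
proof -
  have "qRe (quat_cnj u * q * u) = quat_nsq u * qRe q"
    by (simp add: quat_nsq_def power2_eq_square algebra_simps)
  then show ?thesis
    using assms by simp
qed

text \<open>Conjugation preserves the modulus and the real part, hence also the length of the
  imaginary part.\<close>

lemma norm_quat_Im_conjugate:
  assumes "quat_nsq u = 1"
  shows "norm (quat_Im (quat_cnj u * q * u)) = norm (quat_Im q)"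
proof -
  have "quat_nsq (quat_cnj u * q * u) = quat_nsq q"
    by (simp add: quat_nsq_mult quat_nsq_cnj assms)
  then show ?thesis
    using qRe_conjugate[OF assms, of q] by (simp add: quat_nsq_eq del: quat_mult_sel)
qed

lemma imag_unitsD:
  assumes "m \<in> imag_units"
  shows "qRe m = 0" "norm (quat_Im m) = 1"
proof -
  have sq: "m * m = - 1"
    using assms by (simp add: imag_units_def power2_eq_square)
  have "qRe (m * m) = -1" "qIm1 (m * m) = 0" "qIm2 (m * m) = 0" "qIm3 (m * m) = 0"
    unfolding sq by simp_all
  then have e: "(qRe m)\<^sup>2 - ((qIm1 m)\<^sup>2 + (qIm2 m)\<^sup>2 + (qIm3 m)\<^sup>2) = -1"
    and z: "qRe m * qIm1 m = 0" "qRe m * qIm2 m = 0" "qRe m * qIm3 m = 0"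
    by (auto simp: power2_eq_square)
  show re: "qRe m = 0"
  proof (rule ccontr)
    assume "qRe m \<noteq> 0"
    then have "(qRe m)\<^sup>2 = -1"
      using e z by simp
    then show False
      using zero_le_power2[of "qRe m"] by linarith
  qed
  show "norm (quat_Im m) = 1"
    using e re by (simp add: quat_Im_def norm_Pair add.assoc)
qed

lemma imag_units_square: "m \<in> imag_units \<Longrightarrow> m * m = - 1"
  by (simp add: imag_units_def power2_eq_square)

text \<open>It suffices to find a nonzero \<open>u\<close> with
  \<open>p * u = b *\<^sub>R (u * m)\<close>, where \<open>b\<close> is the length of
  \<open>p\<close>: after normalisation, multiplying by \<open>quat_cnj u\<close> from the left
  gives the claim.\<close>

lemma quat_rotate:
  assumes m: "m \<in> imag_units" and re: "qRe p = 0"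
  obtains u where "quat_nsq u = 1" "quat_cnj u * p * u = norm (quat_Im p) *\<^sub>R m"
proof (cases "p = 0")
  case True
  then show ?thesis
    using that[of 1] by (simp add: quat_nsq_def quat_Im_def)
next
  case False
  define b where "b = norm (quat_Im p)"
  have nb: "quat_nsq p = b\<^sup>2"
    using re by (simp add: quat_nsq_eq b_def)
  have pp: "p * p = - (b\<^sup>2 *\<^sub>R 1)"
    using nb re by (simp add: quat_eq_iff quat_nsq_def power2_eq_square)
  have mm: "m * m = - 1"
    by (rule imag_units_square[OF m])
  have b: "b \<noteq> 0"
    using False nb quat_nsq_eq_0_iff[of p] by auto
  \<comment> \<open>The map sending \<open>w\<close> to \<open>- p * w * m\<close> divided by
    \<open>b\<close> is an involution, by \<open>pp\<close> and \<open>mm\<close>.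
    \<open>U w\<close> is \<open>b\<close> times the sum of \<open>w\<close> and its image, hence a
    fixed point, and fixed points solve the sought equation.\<close>
  define U where "U w = b *\<^sub>R w - p * w * m" for w
  have intertwine: "p * U w = b *\<^sub>R (U w * m)" for w
  proof -
    have "p * U w = b *\<^sub>R (p * w) - (p * p) * w * m"
      by (simp add: U_def algebra_simps)
    also have "\<dots> = b *\<^sub>R (p * w) + b\<^sup>2 *\<^sub>R (w * m)"
      by (simp add: pp algebra_simps)
    finally have 1: "p * U w = b *\<^sub>R (p * w) + b\<^sup>2 *\<^sub>R (w * m)" .
    have "U w * m = b *\<^sub>R (w * m) - p * w * (m * m)"
      by (simp add: U_def algebra_simps)
    then show ?thesis
      unfolding 1 mm by (simp add: algebra_simps power2_eq_square)
  qed
  have "\<exists>w. U w \<noteq> 0"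
  proof (rule ccontr)
    assume "\<not> ?thesis"
    then have U0: "b *\<^sub>R w = p * w * m" for w
      unfolding U_def by (metis eq_iff_diff_eq_0)
    \<comment> \<open>Otherwise \<open>p = - b m\<close>, hence \<open>m\<close> would be central.\<close>
    have comm: "m * w = w * m" for w
    proof -
      have "b *\<^sub>R (w * m) = p * w * (m * m)"
        using arg_cong[OF U0[of w], of "\<lambda>z. z * m"] by (simp add: algebra_simps)
      also have "\<dots> = p * 1 * (m * m) * w"
        by (simp add: mm)
      also have "p * 1 * (m * m) = b *\<^sub>R m"
        using arg_cong[OF U0[of 1], of "\<lambda>z. z * m"] by (simp add: algebra_simps)
      finally show ?thesis
        using b by simp
    qed
    have "m = of_real (qRe m)"
      using comm[of quat_i] comm[of quat_j]
      by (simp add: quat_eq_iff quat_i_def quat_j_def)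
    then have "m = 0"
      using imag_unitsD(1)[OF m] by simp
    then show False
      using mm by simp
  qed
  then obtain w where "U w \<noteq> 0" ..
  then obtain r where r: "r > 0" "quat_nsq (r *\<^sub>R U w) = 1"
    using quat_normalize by blast
  define u where "u = r *\<^sub>R U w"
  have "quat_cnj u * p * u = quat_cnj u * (b *\<^sub>R (u * m))"
    by (simp add: u_def intertwine mult.assoc)
  also have "\<dots> = b *\<^sub>R ((quat_cnj u * u) * m)"
    by (simp add: mult.assoc)
  also have "\<dots> = b *\<^sub>R m"
    unfolding quat_cnj_mult_self using r(2) by (simp add: u_def)
  finally show ?thesis
    using that r(2) by (simp add: u_def b_def)
qed

text \<open>The slice spanned by \<open>1\<close> and \<open>m\<close> is a real plane commuting
  with \<open>m\<close>, and a real functional on a plane has a nonzero kernel.\<close>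

lemma exists_slice_unit_kernel:
  assumes m: "m \<in> imag_units"
    and add: "\<And>u v. \<phi> (u + v) = \<phi> u + \<phi> v"
    and scale: "\<And>r u. \<phi> (r *\<^sub>R u) = r * (\<phi> u :: real)"
  obtains u where "quat_nsq u = 1" "u * m = m * u" "\<phi> u = 0"
proof -
  \<comment> \<open>The usual kernel vector of a functional on a plane; it degenerates when both
    values vanish, and then \<open>1\<close> serves.\<close>
  define v where "v = (if \<phi> m = 0 \<and> \<phi> 1 = 0 then 1 else \<phi> m *\<^sub>R 1 - \<phi> 1 *\<^sub>R m)"
  have v0: "\<phi> v = 0"
    using add[of "\<phi> m *\<^sub>R 1" "(- \<phi> 1) *\<^sub>R m"] scale[of "\<phi> m" 1] scale[of "- \<phi> 1" m]
    by (auto simp: v_def)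
  have comm: "v * m = m * v"
    by (simp add: v_def algebra_simps)
  have "v \<noteq> 0"
  proof
    assume "v = 0"
    then have e: "\<phi> m *\<^sub>R 1 = \<phi> 1 *\<^sub>R m" and ne: "\<not> (\<phi> m = 0 \<and> \<phi> 1 = 0)"
      by (auto simp: v_def split: if_splits)
    have "\<phi> m = 0"
      using arg_cong[OF e, of qRe] imag_unitsD(1)[OF m] by simp
    moreover have "m \<noteq> 0"
      using imag_unitsD(2)[OF m] by (auto simp: quat_Im_def)
    ultimately show False
      using e ne by simp
  qed
  then obtain r where r: "r > 0" "quat_nsq (r *\<^sub>R v) = 1"
    using quat_normalize by blast
  then show ?thesis
    using that[of "r *\<^sub>R v"] comm v0 by (simp add: scale)
qed

subsection \<open>The sesquilinear form of a matrix\<close>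

definition quat_form :: "quat ^ 'n ^ 'n \<Rightarrow> quat ^ 'n \<Rightarrow> quat ^ 'n \<Rightarrow> quat" where
  "quat_form A X Y = quat_inner X (A *v Y)"

text \<open>Scalars act from the right, so this commutes with the matrix action.\<close>

definition vec_rmul :: "quat ^ 'n \<Rightarrow> quat \<Rightarrow> quat ^ 'n" where
  "vec_rmul X u = (\<chi> l. X $ l * u)"

definition quat_cross :: "quat ^ 'n ^ 'n \<Rightarrow> quat ^ 'n \<Rightarrow> quat ^ 'n \<Rightarrow> quat" where
  "quat_cross A X Y = quat_form A X Y + quat_form A Y X"

lemma quat_form_expand:
  "quat_form A X Y = (\<Sum>l\<in>UNIV. \<Sum>j\<in>UNIV. quat_cnj (X $ l) * A $ l $ j * Y $ j)"
  by (simp add: quat_form_def quat_inner_def matrix_vector_mult_def sum_distrib_left mult.assoc)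

lemma quat_form_add_left: "quat_form A (X + X') Y = quat_form A X Y + quat_form A X' Y"
  and quat_form_add_right: "quat_form A X (Y + Y') = quat_form A X Y + quat_form A X Y'"
  and quat_form_scaleR_left: "quat_form A (r *\<^sub>R X) Y = r *\<^sub>R quat_form A X Y"
  and quat_form_scaleR_right: "quat_form A X (r *\<^sub>R Y) = r *\<^sub>R quat_form A X Y"
  and quat_form_rmul_left: "quat_form A (vec_rmul X u) Y = quat_cnj u * quat_form A X Y"
  and quat_form_rmul_right: "quat_form A X (vec_rmul Y u) = quat_form A X Y * u"
  by (simp_all add: quat_form_expand quat_cnj_add quat_cnj_scaleR quat_cnj_mult vec_rmul_def
      sum.distrib scaleR_sum_right sum_distrib_left sum_distrib_right algebra_simps)

lemma quat_form_rmul: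
  "quat_form A (vec_rmul X u) (vec_rmul X u) = quat_cnj u * quat_form A X X * u"
  by (simp add: quat_form_rmul_left quat_form_rmul_right mult.assoc)

lemma quat_form_comb:
  "quat_form A (a *\<^sub>R X + b *\<^sub>R Y) (a *\<^sub>R X + b *\<^sub>R Y)
    = a\<^sup>2 *\<^sub>R quat_form A X X + (a * b) *\<^sub>R quat_cross A X Y + b\<^sup>2 *\<^sub>R quat_form A Y Y"
  by (simp add: quat_form_add_left quat_form_add_right quat_form_scaleR_left
      quat_form_scaleR_right quat_cross_def power2_eq_square algebra_simps)

lemma quat_cross_rmul:
  "quat_cross A X (vec_rmul Y u) = quat_form A X Y * u + quat_cnj u * quat_form A Y X"
  by (simp add: quat_cross_def quat_form_rmul_left quat_form_rmul_right)

text \<open>With the next lemma, the cross term is real linear in \<open>u\<close>, which also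
  enters conjugated; this is the linearity that \<open>exists_slice_unit_kernel\<close> asks
  for.\<close>

lemma quat_cross_rmul_add:
  "quat_cross A X (vec_rmul Y (u + v)) = quat_cross A X (vec_rmul Y u) + quat_cross A X (vec_rmul Y v)"
  by (simp add: quat_cross_rmul quat_cnj_add algebra_simps)

lemma quat_cross_rmul_scaleR:
  "quat_cross A X (vec_rmul Y (r *\<^sub>R u)) = r *\<^sub>R quat_cross A X (vec_rmul Y u)"
  by (simp add: quat_cross_rmul quat_cnj_scaleR algebra_simps)

text \<open>Written as the form of the identity matrix so that the expansion rules for forms cover
  the norm as well.\<close>

definition vec_nsq :: "quat ^ 'n \<Rightarrow> real" where
  "vec_nsq X = qRe (quat_form (mat 1) X X)"

lemma vec_nsq_inner: "vec_nsq X = qRe (quat_inner X X)"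
  by (simp add: vec_nsq_def quat_form_def)

lemma vec_nsq_nonneg: "0 \<le> vec_nsq X"
  unfolding vec_nsq_inner by (rule quat_inner_self)

lemma vec_nsq_eq_0:
  assumes "vec_nsq X = 0"
  shows "X = 0"
proof -
  have "vec_nsq X = (\<Sum>l\<in>UNIV. quat_nsq (X $ l))"
    unfolding vec_nsq_inner quat_inner_def quat_cnj_mult_self of_real_sum[symmetric]
    by (simp del: of_real_sum)
  then have "\<forall>l\<in>UNIV. quat_nsq (X $ l) = 0"
    using assms sum_nonneg_eq_0_iff[of UNIV "\<lambda>l. quat_nsq (X $ l)"] quat_nsq_nonneg by simp
  then show ?thesis
    by (simp add: quat_nsq_eq_0_iff vec_eq_iff)
qed

lemma unit_sphere_iff: "X \<in> quat_unit_sphere \<longleftrightarrow> vec_nsq X = 1"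
  by (simp add: quat_unit_sphere_def quat_vec_norm_def vec_nsq_inner)

lemma quat_num_range_alt: "quat_num_range A = {quat_form A X X | X. vec_nsq X = 1}"
  by (simp add: quat_num_range_def quat_form_def unit_sphere_iff)

lemma vec_nsq_scaleR: "vec_nsq (r *\<^sub>R X) = r\<^sup>2 * vec_nsq X"
  by (simp add: vec_nsq_def quat_form_scaleR_left quat_form_scaleR_right power2_eq_square)

lemma vec_nsq_rmul: "quat_nsq u = 1 \<Longrightarrow> vec_nsq (vec_rmul X u) = vec_nsq X"
  unfolding vec_nsq_def quat_form_rmul by (rule qRe_conjugate)

subsection \<open>The profile of the numerical range\<close>

text \<open>The numerical range is invariant under conjugation by unit quaternions, so its section by
  any slice is a copy of this planar set.\<close>

definition profile :: "quat ^ 'n ^ 'n \<Rightarrow> (real \<times> real) set" where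
  "profile A = {(qRe (quat_form A X X), norm (quat_Im (quat_form A X X))) | X. vec_nsq X = 1}"

lemma slice_mem_iff:
  assumes m: "m \<in> imag_units" and b: "0 \<le> b"
  shows "of_real a + m * of_real b \<in> quat_num_range A \<longleftrightarrow> (a, b) \<in> profile A"
proof
  assume "of_real a + m * of_real b \<in> quat_num_range A"
  then obtain X where X: "vec_nsq X = 1" "quat_form A X X = of_real a + m * of_real b"
    unfolding quat_num_range_alt by force
  have "quat_form A X X = of_real a + b *\<^sub>R m"
    unfolding X(2) by (simp add: of_real_def)
  then have "qRe (quat_form A X X) = a" "quat_Im (quat_form A X X) = b *\<^sub>R quat_Im m"
    using imag_unitsD[OF m] by (simp_all add: quat_Im_def)
  then show "(a, b) \<in> profile A"
    unfolding profile_def using X(1) b imag_unitsD[OF m] by force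
next
  assume "(a, b) \<in> profile A"
  then obtain X where X: "vec_nsq X = 1" "qRe (quat_form A X X) = a"
      "norm (quat_Im (quat_form A X X)) = b"
    unfolding profile_def by auto
  \<comment> \<open>Real quaternions are central, so conjugation fixes the real part and acts only
    on \<open>p\<close>.\<close>
  define p where "p = quat_form A X X - of_real a"
  have p: "qRe p = 0" "norm (quat_Im p) = b"
    using X by (simp_all add: p_def quat_Im_def)
  obtain u where u: "quat_nsq u = 1" "quat_cnj u * p * u = norm (quat_Im p) *\<^sub>R m"
    using quat_rotate[OF m p(1)] .
  have "quat_form A (vec_rmul X u) (vec_rmul X u) = quat_cnj u * (of_real a + p) * u"
    by (simp add: quat_form_rmul p_def)
  also have "\<dots> = a *\<^sub>R (quat_cnj u * u) + quat_cnj u * p * u"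
    by (simp add: algebra_simps of_real_def)
  also have "\<dots> = of_real a + m * of_real b"
    by (simp add: u p quat_cnj_mult_self of_real_def)
  finally show "of_real a + m * of_real b \<in> quat_num_range A"
    unfolding quat_num_range_alt using X(1) vec_nsq_rmul[OF u(1), of X] by force
qed

section \<open>Profile points from segments of vectors\<close>

lemma profile_nonneg: "(a, b) \<in> profile A \<Longrightarrow> 0 \<le> b"
  by (auto simp: profile_def)

text \<open>Numerators and denominator are homogeneous of degree two under positive real scaling, so
  vectors on a segment need not be normalised.\<close>

lemma profileI:
  assumes "vec_nsq Z > 0"
  shows "(qRe (quat_form A Z Z) / vec_nsq Z, norm (quat_Im (quat_form A Z Z)) / vec_nsq Z) \<in> profile A"
proof -
  define r where "r = inverse (sqrt (vec_nsq Z))"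
  have r: "r * r = inverse (vec_nsq Z)"
    using assms by (simp add: r_def flip: inverse_mult_distrib)
  have "vec_nsq (r *\<^sub>R Z) = 1"
    using assms by (simp add: vec_nsq_scaleR power2_eq_square r)
  moreover have "quat_form A (r *\<^sub>R Z) (r *\<^sub>R Z) = inverse (vec_nsq Z) *\<^sub>R quat_form A Z Z"
    by (simp add: quat_form_scaleR_left quat_form_scaleR_right r)
  ultimately show ?thesis
    unfolding profile_def using assms
    by (auto intro!: exI[of _ "r *\<^sub>R Z"] simp: quat_Im_scaleR divide_inverse_commute)
qed

text \<open>At a zero, equal lengths would force \<open>X = - Y\<close>; but the form takes the same
  value at a vector and at its negative.\<close>

lemma segment_nonzero:
  assumes X: "vec_nsq X = 1" and Y: "vec_nsq Y = 1"
    and ne: "quat_form A X X \<noteq> quat_form A Y Y"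
  shows "vec_nsq ((1 - s) *\<^sub>R X + s *\<^sub>R Y) > 0"
proof (rule ccontr)
  assume "\<not> ?thesis"
  then have "vec_nsq ((1 - s) *\<^sub>R X + s *\<^sub>R Y) = 0"
    using vec_nsq_nonneg[of "(1 - s) *\<^sub>R X + s *\<^sub>R Y"] by linarith
  then have "(1 - s) *\<^sub>R X + s *\<^sub>R Y = 0"
    by (rule vec_nsq_eq_0)
  then have e: "(1 - s) *\<^sub>R X = (- s) *\<^sub>R Y"
    by (simp add: eq_neg_iff_add_eq_0)
  have "(1 - s)\<^sup>2 = s\<^sup>2"
    using arg_cong[OF e, of vec_nsq] unfolding vec_nsq_scaleR X Y by simp
  then have s: "s = 1 / 2"
    by (simp add: power2_eq_square algebra_simps)
  have "(1 / 2 * (1 / 2)) *\<^sub>R quat_form A X X = (1 / 2 * (1 / 2)) *\<^sub>R quat_form A Y Y"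
    using arg_cong[OF e, of "\<lambda>Z. quat_form A Z Z"]
    unfolding quat_form_scaleR_left quat_form_scaleR_right s by simp
  then show False
    using ne by simp
qed

text \<open>A unit \<open>u\<close> killing the cross term of \<open>A - a\<close> keeps the real part equal to \<open>a\<close>
  along the whole segment.\<close>

lemma profile_vertical:
  fixes A :: "quat ^ 'n ^ 'n"
  assumes 1: "(a, b1) \<in> profile A" and 2: "(a, b2) \<in> profile A" and b: "b1 \<le> b" "b \<le> b2"
    and m: "m \<in> imag_units"
  shows "(a, b) \<in> profile A"
proof (cases "b1 = b2")
  case True
  then show ?thesis
    using 1 b by simp
next
  case False
  obtain X where X: "vec_nsq X = 1" "qRe (quat_form A X X) = a"
      "norm (quat_Im (quat_form A X X)) = b1"
    using 1 unfolding profile_def by auto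
  obtain Y where Y: "vec_nsq Y = 1" "qRe (quat_form A Y Y) = a"
      "norm (quat_Im (quat_form A Y Y)) = b2"
    using 2 unfolding profile_def by auto
  \<comment> \<open>The functional is the real part of the cross term of \<open>A\<close> minus
    \<open>a\<close> times the identity.\<close>
  obtain u where u: "quat_nsq u = 1"
    and u0: "qRe (quat_cross A X (vec_rmul Y u)) - a * qRe (quat_cross (mat 1) X (vec_rmul Y u)) = 0"
    by (rule exists_slice_unit_kernel[OF m, of "\<lambda>u. qRe (quat_cross A X (vec_rmul Y u))
            - a * qRe (quat_cross (mat 1) X (vec_rmul Y u))"])
      (auto simp: quat_cross_rmul_add quat_cross_rmul_scaleR algebra_simps)
  define Y' where "Y' = vec_rmul Y u"
  \<comment> \<open>Passing to \<open>Y'\<close> conjugates the value by \<open>u\<close>, which may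
    move its imaginary part but keeps the profile point.\<close>
  have Y': "vec_nsq Y' = 1" "qRe (quat_form A Y' Y') = a"
      "norm (quat_Im (quat_form A Y' Y')) = b2"
    unfolding Y'_def quat_form_rmul vec_nsq_rmul[OF u] qRe_conjugate[OF u]
      norm_quat_Im_conjugate[OF u] by (fact Y)+
  define Z where "Z s = (1 - s) *\<^sub>R X + s *\<^sub>R Y'" for s :: real
  have pos: "vec_nsq (Z s) > 0" for s
    unfolding Z_def using X Y' False by (intro segment_nonzero[of _ _ A]) auto
  have form: "quat_form C (Z s) (Z s) = (1 - s)\<^sup>2 *\<^sub>R quat_form C X X
      + ((1 - s) * s) *\<^sub>R quat_cross C X Y' + s\<^sup>2 *\<^sub>R quat_form C Y' Y'" for C s
    unfolding Z_def by (rule quat_form_comb)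
  have re: "qRe (quat_form A (Z s) (Z s)) = a * vec_nsq (Z s)" for s
  proof -
    have c: "qRe (quat_cross A X Y') = a * qRe (quat_cross (mat 1) X Y')"
      using u0 by (simp add: Y'_def)
    show ?thesis
      unfolding vec_nsq_def form using X Y' c by (simp add: vec_nsq_def algebra_simps)
  qed
  \<comment> \<open>By \<open>re\<close>, the normalised points of the segment have first coordinate
    \<open>a\<close>; \<open>g\<close> is their second coordinate.\<close>
  define g where "g s = norm (quat_Im (quat_form A (Z s) (Z s))) / vec_nsq (Z s)" for s
  have "continuous_on {0..1} (\<lambda>s. vec_nsq (Z s))"
    unfolding vec_nsq_def form by (simp, intro continuous_intros)
  moreover have "continuous_on {0..1} (\<lambda>s. norm (quat_Im (quat_form A (Z s) (Z s))))"
    unfolding form quat_Im_add quat_Im_scaleR by (intro continuous_intros)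
  ultimately have cont: "continuous_on {0..1} g"
    unfolding g_def using pos by (intro continuous_on_divide) (auto simp: less_imp_neq[symmetric])
  have "g 0 = b1" "g 1 = b2"
    by (simp_all add: g_def Z_def X Y')
  then obtain s where "g s = b"
    using IVT'[of g 0 b 1] b cont by auto
  then show ?thesis
    using profileI[OF pos[of s], of A] pos[of s] by (simp add: g_def re)
qed

text \<open>The intermediate value theorem for the real part of the form of \<open>A\<close> minus
  \<open>a\<close> times the identity, which is negative at \<open>X\<close> and positive at
  \<open>Y\<close>.\<close>

lemma segment_Re_value:
  fixes A :: "quat ^ 'n ^ 'n"
  assumes X: "vec_nsq X = 1" "qRe (quat_form A X X) = a1"
    and Y: "vec_nsq Y = 1" "qRe (quat_form A Y Y) = a2"
    and a: "a1 < a" "a < a2"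
  obtains s where "0 < s" "s < 1" "vec_nsq ((1 - s) *\<^sub>R X + s *\<^sub>R Y) > 0"
    "qRe (quat_form A ((1 - s) *\<^sub>R X + s *\<^sub>R Y) ((1 - s) *\<^sub>R X + s *\<^sub>R Y))
      = a * vec_nsq ((1 - s) *\<^sub>R X + s *\<^sub>R Y)"
proof -
  define Z where "Z s = (1 - s) *\<^sub>R X + s *\<^sub>R Y" for s :: real
  have pos: "vec_nsq (Z s) > 0" for s
    unfolding Z_def using X Y a by (intro segment_nonzero[of _ _ A]) auto
  have form: "quat_form C (Z s) (Z s) = (1 - s)\<^sup>2 *\<^sub>R quat_form C X X
      + ((1 - s) * s) *\<^sub>R quat_cross C X Y + s\<^sup>2 *\<^sub>R quat_form C Y Y" for C s
    unfolding Z_def by (rule quat_form_comb)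
  define g where "g s = qRe (quat_form A (Z s) (Z s)) - a * vec_nsq (Z s)" for s
  have "continuous_on {0..1} g"
    unfolding g_def vec_nsq_def form by (simp, intro continuous_intros)
  moreover have g: "g 0 < 0" "g 1 > 0"
    using a by (simp_all add: g_def Z_def X Y)
  ultimately obtain s where s: "0 \<le> s" "s \<le> 1" "g s = 0"
    using IVT'[of g 0 0 1] by (auto simp: less_imp_le)
  then have "s \<noteq> 0" "s \<noteq> 1"
    using g by auto
  then show ?thesis
    using that[of s] s pos[of s] by (simp add: g_def Z_def)
qed

text \<open>A unit \<open>u\<close> killing the imaginary cross term turns the triangle inequality for the imaginary
  part into a bound by the chord; its sign is still free and is chosen to favour the chord.\<close>

lemma profile_below_chord:
  fixes A :: "quat ^ 'n ^ 'n"
  assumes 1: "(a1, \<beta> * a1 + \<gamma>) \<in> profile A" and 2: "(a2, \<beta> * a2 + \<gamma>) \<in> profile A"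
    and a: "a1 < a" "a < a2"
  obtains b where "(a, b) \<in> profile A" "b \<le> \<beta> * a + \<gamma>"
proof -
  obtain X where X: "vec_nsq X = 1" "qRe (quat_form A X X) = a1"
      "norm (quat_Im (quat_form A X X)) = \<beta> * a1 + \<gamma>"
    using 1 unfolding profile_def by auto
  obtain Y where Y: "vec_nsq Y = 1" "qRe (quat_form A Y Y) = a2"
      "norm (quat_Im (quat_form A Y Y)) = \<beta> * a2 + \<gamma>"
    using 2 unfolding profile_def by auto
  \<comment> \<open>In homogeneous form the chord is \<beta> times the real part plus \<gamma> times
    the squared norm; \<open>L u\<close> is the cross term of this real quadratic form.\<close>
  define L where "L u = \<beta> * qRe (quat_cross A X (vec_rmul Y u))
      + \<gamma> * qRe (quat_cross (mat 1) X (vec_rmul Y u))" for u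
  \<comment> \<open>Quaternion conjugation negates imaginary parts and reverses products, so the
    term with \<open>quat_cnj u\<close> can be rewritten with \<open>u\<close> on the right and
    merged with the other one.\<close>
  define c where "c = quat_form A X Y - quat_cnj (quat_form A Y X)"
  have imc: "quat_Im (quat_cross A X (vec_rmul Y u)) = quat_Im (c * u)" for u
    by (simp add: quat_cross_rmul c_def quat_Im_def algebra_simps)
  \<comment> \<open>\<open>c * quat_cnj c\<close> is real; for \<open>c = 0\<close> every choice
    kills the term.\<close>
  define v where "v = (if c = 0 then 1 else quat_cnj c)"
  have "v \<noteq> 0"
    using quat_nsq_cnj[of c] quat_nsq_eq_0_iff by (metis v_def zero_neq_one)
  then obtain r where r: "quat_nsq (r *\<^sub>R v) = 1"
    using quat_normalize by blast
  have im0: "quat_Im (c * (t *\<^sub>R v)) = 0" for t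
    by (simp add: v_def quat_Im_def zero_prod_def algebra_simps)
  \<comment> \<open>Negating the unit preserves the vanishing of the imaginary cross term and
    negates \<open>L\<close>, so \<open>L u \<ge> 0\<close> can be arranged.\<close>
  define \<sigma> :: real where "\<sigma> = (if L (r *\<^sub>R v) \<ge> 0 then 1 else -1)"
  define u where "u = \<sigma> *\<^sub>R (r *\<^sub>R v)"
  have u: "quat_nsq u = 1"
    unfolding u_def quat_nsq_scaleR[of \<sigma>] r by (simp add: \<sigma>_def)
  have "L u = \<sigma> * L (r *\<^sub>R v)"
    unfolding L_def u_def quat_cross_rmul_scaleR[of _ _ _ \<sigma>] by (simp add: algebra_simps)
  then have Lu: "L u \<ge> 0"
    by (simp add: \<sigma>_def)
  define Y' where "Y' = vec_rmul Y u"
  have Y': "vec_nsq Y' = 1" "qRe (quat_form A Y' Y') = a2"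
      "norm (quat_Im (quat_form A Y' Y')) = \<beta> * a2 + \<gamma>"
    unfolding Y'_def quat_form_rmul vec_nsq_rmul[OF u] qRe_conjugate[OF u]
      norm_quat_Im_conjugate[OF u] by (fact Y)+
  have im_cross: "quat_Im (quat_cross A X Y') = 0"
    using im0[of "\<sigma> * r"] by (simp add: Y'_def imc u_def)
  obtain s where s: "0 < s" "s < 1" and pos: "vec_nsq ((1 - s) *\<^sub>R X + s *\<^sub>R Y') > 0"
    and re: "qRe (quat_form A ((1 - s) *\<^sub>R X + s *\<^sub>R Y') ((1 - s) *\<^sub>R X + s *\<^sub>R Y'))
      = a * vec_nsq ((1 - s) *\<^sub>R X + s *\<^sub>R Y')"
    using segment_Re_value[OF X(1,2) Y'(1,2) a] .
  define Z where "Z = (1 - s) *\<^sub>R X + s *\<^sub>R Y'"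
  note posZ = pos[folded Z_def] and reZ = re[folded Z_def]
  have form: "quat_form C Z Z = (1 - s)\<^sup>2 *\<^sub>R quat_form C X X
      + ((1 - s) * s) *\<^sub>R quat_cross C X Y' + s\<^sup>2 *\<^sub>R quat_form C Y' Y'" for C
    unfolding Z_def by (rule quat_form_comb)
  have "norm (quat_Im (quat_form A Z Z))
      = norm ((1 - s)\<^sup>2 *\<^sub>R quat_Im (quat_form A X X) + s\<^sup>2 *\<^sub>R quat_Im (quat_form A Y' Y'))"
    unfolding form quat_Im_add quat_Im_scaleR im_cross by simp
  also have "\<dots> \<le> (1 - s)\<^sup>2 * (\<beta> * a1 + \<gamma>) + s\<^sup>2 * (\<beta> * a2 + \<gamma>)"
    by (rule norm_triangle_le) (simp add: X Y')
  also have "\<dots> \<le> (1 - s)\<^sup>2 * (\<beta> * a1 + \<gamma>) + s\<^sup>2 * (\<beta> * a2 + \<gamma>) + ((1 - s) * s) * L u"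
    using s Lu by simp
  also have "\<dots> = \<beta> * qRe (quat_form A Z Z) + \<gamma> * vec_nsq Z"
    unfolding vec_nsq_def form using X Y' by (simp add: vec_nsq_def L_def Y'_def algebra_simps)
  also have "\<dots> = (\<beta> * a + \<gamma>) * vec_nsq Z"
    by (simp add: reZ algebra_simps)
  finally have "norm (quat_Im (quat_form A Z Z)) / vec_nsq Z \<le> \<beta> * a + \<gamma>"
    using posZ by (simp add: divide_le_eq)
  then show ?thesis
    using that profileI[OF posZ, of A] posZ by (simp add: reZ)
qed

text \<open>The classical Toeplitz--Hausdorff argument in the slice of \<open>m\<close>, applied to the component of
  the imaginary part along \<open>m\<close>, which is a lower bound for its norm.\<close>

lemma profile_above_chord:
  fixes A :: "quat ^ 'n ^ 'n"
  assumes m: "m \<in> imag_units"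
    and 1: "(a1, \<beta> * a1 + \<gamma>) \<in> profile A" and 2: "(a2, \<beta> * a2 + \<gamma>) \<in> profile A"
    and a: "a1 < a" "a < a2"
  obtains b where "(a, b) \<in> profile A" "\<beta> * a + \<gamma> \<le> b"
proof -
  \<comment> \<open>Rotated representatives put both end values into the slice of
    \<open>m\<close>.\<close>
  have aligned: "\<exists>X. vec_nsq X = 1 \<and> quat_form A X X = of_real x + m * of_real y"
    if "(x, y) \<in> profile A" for x y
  proof -
    have "of_real x + m * of_real y \<in> quat_num_range A"
      using slice_mem_iff[OF m profile_nonneg[OF that]] that by blast
    then show ?thesis
      unfolding quat_num_range_alt by force
  qed
  obtain X where X: "vec_nsq X = 1" and fX: "quat_form A X X = of_real a1 + m * of_real (\<beta> * a1 + \<gamma>)"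
    using aligned[OF 1] by blast
  obtain Y where Y: "vec_nsq Y = 1" and fY: "quat_form A Y Y = of_real a2 + m * of_real (\<beta> * a2 + \<gamma>)"
    using aligned[OF 2] by blast
  \<comment> \<open>The cross term of a real quadratic form, the imaginary component along
    \<open>m\<close> minus the homogeneous chord; that form vanishes at both end vectors.\<close>
  define \<phi> where "\<phi> u = quat_Im (quat_cross A X (vec_rmul Y u)) \<bullet> quat_Im m
      - \<beta> * qRe (quat_cross A X (vec_rmul Y u)) - \<gamma> * qRe (quat_cross (mat 1) X (vec_rmul Y u))" for u
  obtain u where u: "quat_nsq u = 1" and um: "u * m = m * u" and u0: "\<phi> u = 0"
    by (rule exists_slice_unit_kernel[OF m, of \<phi>])
      (auto simp: \<phi>_def quat_cross_rmul_add quat_cross_rmul_scaleR quat_Im_add quat_Im_scaleR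
        inner_add_left algebra_simps)
  define Y' where "Y' = vec_rmul Y u"
  have Y': "vec_nsq Y' = 1"
    unfolding Y'_def vec_nsq_rmul[OF u] by (fact Y)
  \<comment> \<open>\<open>u\<close> commutes with \<open>m\<close>, hence with the end value, so
    conjugation fixes the value itself and not merely its profile point.\<close>
  have "u * quat_form A Y Y = quat_form A Y Y * u"
    unfolding fY using um by (simp add: of_real_def algebra_simps)
  then have "quat_form A Y' Y' = (quat_cnj u * u) * quat_form A Y Y"
    by (simp add: Y'_def quat_form_rmul mult.assoc)
  then have fY': "quat_form A Y' Y' = of_real a2 + m * of_real (\<beta> * a2 + \<gamma>)"
    by (simp add: quat_cnj_mult_self u fY)
  have mm: "quat_Im m \<bullet> quat_Im m = 1"
    using imag_unitsD(2)[OF m] by (simp add: dot_square_norm)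
  have re: "qRe (of_real x + m * of_real y) = x" and
    im: "quat_Im (of_real x + m * of_real y) \<bullet> quat_Im m = y" for x y
  proof -
    show "qRe (of_real x + m * of_real y) = x"
      using imag_unitsD(1)[OF m] by simp
    have "quat_Im (of_real x + m * of_real y) = y *\<^sub>R quat_Im m"
      by (simp add: quat_Im_def)
    then show "quat_Im (of_real x + m * of_real y) \<bullet> quat_Im m = y"
      by (simp add: mm)
  qed
  have X2: "qRe (quat_form A X X) = a1" and Y2: "qRe (quat_form A Y' Y') = a2"
    unfolding fX fY' re by simp_all
  have imX: "quat_Im (quat_form A X X) \<bullet> quat_Im m = \<beta> * a1 + \<gamma>"
    and imY: "quat_Im (quat_form A Y' Y') \<bullet> quat_Im m = \<beta> * a2 + \<gamma>"
    unfolding fX fY' im by simp_all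
  obtain s where s: "0 < s" "s < 1" and pos: "vec_nsq ((1 - s) *\<^sub>R X + s *\<^sub>R Y') > 0"
    and reZ': "qRe (quat_form A ((1 - s) *\<^sub>R X + s *\<^sub>R Y') ((1 - s) *\<^sub>R X + s *\<^sub>R Y'))
      = a * vec_nsq ((1 - s) *\<^sub>R X + s *\<^sub>R Y')"
    using segment_Re_value[OF X X2 Y' Y2 a] .
  define Z where "Z = (1 - s) *\<^sub>R X + s *\<^sub>R Y'"
  note posZ = pos[folded Z_def] and reZ = reZ'[folded Z_def]
  have form: "quat_form C Z Z = (1 - s)\<^sup>2 *\<^sub>R quat_form C X X
      + ((1 - s) * s) *\<^sub>R quat_cross C X Y' + s\<^sup>2 *\<^sub>R quat_form C Y' Y'" for C
    unfolding Z_def by (rule quat_form_comb)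
  have c: "quat_Im (quat_cross A X Y') \<bullet> quat_Im m
      = \<beta> * qRe (quat_cross A X Y') + \<gamma> * qRe (quat_cross (mat 1) X Y')"
    using u0 by (simp add: \<phi>_def Y'_def)
  \<comment> \<open>End values and cross terms agree, so the component along \<open>m\<close> equals
    the homogeneous chord; only Cauchy-Schwarz introduces an inequality.\<close>
  have "(\<beta> * a + \<gamma>) * vec_nsq Z = \<beta> * qRe (quat_form A Z Z) + \<gamma> * vec_nsq Z"
    by (simp add: reZ algebra_simps)
  also have "\<dots> = (1 - s)\<^sup>2 * (\<beta> * a1 + \<gamma>)
      + ((1 - s) * s) * (quat_Im (quat_cross A X Y') \<bullet> quat_Im m) + s\<^sup>2 * (\<beta> * a2 + \<gamma>)"
    unfolding vec_nsq_def form using X Y' X2 Y2 by (simp add: vec_nsq_def c algebra_simps)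
  also have "\<dots> = quat_Im (quat_form A Z Z) \<bullet> quat_Im m"
    unfolding form quat_Im_add quat_Im_scaleR inner_add_left inner_scaleR_left imX imY ..
  also have "\<dots> \<le> norm (quat_Im (quat_form A Z Z)) * norm (quat_Im m)"
    by (rule norm_cauchy_schwarz)
  finally have "\<beta> * a + \<gamma> \<le> norm (quat_Im (quat_form A Z Z)) / vec_nsq Z"
    using posZ imag_unitsD(2)[OF m] by (simp add: le_divide_eq)
  then show ?thesis
    using that profileI[OF posZ, of A] posZ by (simp add: reZ)
qed

text \<open>For different first coordinates, a point of the chord lies between profile points below
  and above it on the same vertical line, and \<open>profile_vertical\<close> fills the gap; for
  equal ones the end points themselves play that part.\<close>

lemma convex_profile:
  fixes A :: "quat ^ 'n ^ 'n"
  assumes m: "m \<in> imag_units"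
  shows "convex (profile A)"
proof -
  have main: "(x * a1 + y * a2, x * b1 + y * b2) \<in> profile A"
    if 1: "(a1, b1) \<in> profile A" and 2: "(a2, b2) \<in> profile A"
      and xy: "0 < x" "0 < y" "x + y = 1" and le: "a1 \<le> a2"
    for a1 b1 a2 b2 x y
  proof (cases "a1 = a2")
    case True
    have e: "x * a1 + y * a2 = a2"
      using xy True by (metis distrib_right mult_1)
    show ?thesis
    proof (cases "b1 \<le> b2")
      case True
      have "b1 \<le> x * b1 + y * b2" "x * b1 + y * b2 \<le> b2"
        using convex_bound_le[of "-b1" "-b1" "-b2" x y] convex_bound_le[of b1 b2 b2 x y] xy True
        by simp_all
      then show ?thesis
        unfolding e using profile_vertical[OF _ 2 _ _ m] 1 \<open>a1 = a2\<close> by blast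
    next
      case False
      have "b2 \<le> x * b1 + y * b2" "x * b1 + y * b2 \<le> b1"
        using convex_bound_le[of "-b1" "-b2" "-b2" x y] convex_bound_le[of b1 b1 b2 x y] xy False
        by simp_all
      then show ?thesis
        unfolding e using profile_vertical[OF 2 _ _ _ m] 1 \<open>a1 = a2\<close> by blast
    qed
  next
    case False
    with le have lt: "a1 < a2"
      by simp
    define \<beta> where "\<beta> = (b2 - b1) / (a2 - a1)"
    define \<gamma> where "\<gamma> = b1 - \<beta> * a1"
    have b1: "b1 = \<beta> * a1 + \<gamma>"
      by (simp add: \<gamma>_def)
    have "\<beta> * (a2 - a1) = b2 - b1"
      using lt by (simp add: \<beta>_def)
    then have b2: "b2 = \<beta> * a2 + \<gamma>"
      by (simp add: \<gamma>_def algebra_simps)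
    define a where "a = x * a1 + y * a2"
    have x: "x = 1 - y"
      using xy by simp
    have "a - a1 = y * (a2 - a1)" "a2 - a = x * (a2 - a1)"
      unfolding a_def x by (simp_all add: algebra_simps)
    then have a: "a1 < a" "a < a2"
      using lt xy by (metis diff_gt_0_iff_gt mult_pos_pos)+
    have b: "x * b1 + y * b2 = \<beta> * a + \<gamma>"
      unfolding a_def b1 b2 x by (simp add: algebra_simps)
    obtain c where c: "(a, c) \<in> profile A" "c \<le> \<beta> * a + \<gamma>"
      using profile_below_chord[OF 1[unfolded b1] 2[unfolded b2] a] .
    obtain d where d: "(a, d) \<in> profile A" "\<beta> * a + \<gamma> \<le> d"
      using profile_above_chord[OF m 1[unfolded b1] 2[unfolded b2] a] .
    show ?thesis
      unfolding b a_def[symmetric] by (rule profile_vertical[OF c(1) d(1) c(2) d(2) m])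
  qed
  show ?thesis
    unfolding convex_def
  proof (intro ballI allI impI)
    fix p q :: "real \<times> real" and x y :: real
    assume p: "p \<in> profile A" and q: "q \<in> profile A" and xy: "0 \<le> x" "0 \<le> y" "x + y = 1"
    obtain a1 b1 a2 b2 where pq: "p = (a1, b1)" "q = (a2, b2)"
      by (cases p, cases q)
    \<comment> \<open>\<open>main\<close> needs positive weights and ordered first coordinates; the
      reversed order swaps the two points.\<close>
    consider "x = 0" | "y = 0" | "0 < x" "0 < y" "a1 \<le> a2" | "0 < x" "0 < y" "a2 \<le> a1"
      using xy by linarith
    then show "x *\<^sub>R p + y *\<^sub>R q \<in> profile A"
    proof cases
      case 3
      then show ?thesis
        using main[of a1 b1 a2 b2 x y] p q xy by (simp add: pq)
    next
      case 4
      then show ?thesis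
        using main[of a2 b2 a1 b1 y x] p q xy by (simp add: pq add.commute)
    qed (use p q xy in simp_all)
  qed
qed

section \<open>Transfer from the profile to the slice\<close>

theorem theorem2p15:
  fixes A :: "quat ^ 'n ^ 'n"
  shows "\<forall>m\<in>imag_units. convex (quat_num_range A \<inter> upper_half_slice m)"
proof
  fix m assume m: "m \<in> imag_units"
  \<comment> \<open>The real linear parametrisation of the slice; profile points have nonnegative
    second coordinate, so their images lie in the upper half.\<close>
  define f where "f p = of_real (fst p) + m * of_real (snd p)" for p :: "real \<times> real"
  have "linear f"
    by (rule linearI) (simp_all add: f_def of_real_def algebra_simps)
  moreover have "quat_num_range A \<inter> upper_half_slice m = f ` profile A"
  proof (intro equalityI subsetI)
    fix q assume "q \<in> quat_num_range A \<inter> upper_half_slice m"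
    then obtain a b where "q = of_real a + m * of_real b" "0 \<le> b" "q \<in> quat_num_range A"
      unfolding upper_half_slice_def by blast
    then show "q \<in> f ` profile A"
      using slice_mem_iff[OF m, of b a A] by (intro image_eqI[of _ _ "(a, b)"]) (simp_all add: f_def)
  next
    fix q assume "q \<in> f ` profile A"
    then obtain a b where "(a, b) \<in> profile A" "q = of_real a + m * of_real b"
      by (auto simp: f_def)
    then show "q \<in> quat_num_range A \<inter> upper_half_slice m"
      using slice_mem_iff[OF m, of b a A] profile_nonneg[of a b A]
      unfolding upper_half_slice_def by blast
  qed
  ultimately show "convex (quat_num_range A \<inter> upper_half_slice m)"
    using convex_linear_image[OF _ convex_profile[OF m]] by metis
qed

end
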